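(* The NAND groupoid $2_{14}$, i.e. the groupoid on $\{0,1\}$ with binary operation $\star$ given by $0\star 0=0\star 1=1\star 0=1$ and $1\star 1=0$, is completely dissociative.
   Context: A groupoid $\langle G;\diamond\rangle$ is a set $G$ with a binary operation $\diamond$ on $G$. $\mathbf{N}=\{1,2,3,\ldots\}$, and $G^\omega$ is the set of infinite sequences $\vec g=g_0g_1g_2\ldots$ of elements of $G$. For $k\in\mathbf{N}$, $F^\sigma(k)$ is the set of formal $k$-products: the finite words $\mathbf{u}$ over the alphabet $\{\bullet,x_0,x_1,x_2,\ldots\}$ such that (1) $x_0x_1\ldots x_{k-1}$ is a subsequence of $\mathbf{u}$; (2) $\mathbf{u}$ has length $2k-1$; (3) $\bullet$ occurs exactly $k-1$ times in $\mathbf{u}$; (4) in every nonempty prefix of $\mathbf{u}$ the number of occurrences of $\bullet$ is strictly less than the number of other letters. These are exactly the reverse Polish forms of the full parenthesizations of $x_0x_1\ldots x_{k-1}$ (each variable once, in this order). For $\mathbf{u}\in F^\sigma(k)$ and $\vec g\in G^\omega$, $\vec g\,\mathbf{u}^\diamond\in G$ is the element obtained by replacing each $x_i$ in $\mathbf{u}$ by $g_i$ and each $\bullet$ by $\diamond$ and evaluating in reverse Polish notation ($ab\diamond$ means $a\diamond b$). $\langle G;\diamond\rangle$ is $k$-dissociative iff for every pair $\mathbf{u}\neq\mathbf{v}$ in $F^\sigma(k)$ there is $\vec g\in G^\omega$ with $\vec g\,\mathbf{u}^\diamond\neq\vec g\,\mathbf{v}^\diamond$. It is completely dissociative iff it is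 $k$-dissociative for every $k\ge 3$. *)

theory Defs
  imports Main "HOL-Library.Sublist"
begin

datatype letter = Bullet | Var nat

text \<open>
  In a list, the head is the leftmost letter of the word; \<open>subseq\<close> is the scattered
  (not necessarily contiguous) subsequence relation.
\<close>

definition formal_products :: "nat \<Rightarrow> letter list set" where
  "formal_products k =
    {u. subseq (map Var [0..<k]) u \<and>
        length u = 2 * k - 1 \<and>
        count_list u Bullet = k - 1 \<and>
        (\<forall>p. prefix p u \<and> p \<noteq> [] \<longrightarrow>
           count_list p Bullet < length (filter (\<lambda>c. c \<noteq> Bullet) p))}"

text \<open>
  Evaluation in reverse Polish notation by a stack whose top is the head of the list, so that
  the second operand is popped first.  The last equation (stack underflow) and the value
  \<open>hd []\<close> are never reached on formal products, because of the prefix condition.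
\<close>

fun rpn_step :: "('a \<Rightarrow> 'a \<Rightarrow> 'a) \<Rightarrow> (nat \<Rightarrow> 'a) \<Rightarrow> letter \<Rightarrow> 'a list \<Rightarrow> 'a list" where
  "rpn_step f g (Var i) s = g i # s"
| "rpn_step f g Bullet (b # a # s) = f a b # s"
| "rpn_step f g Bullet s = s"

definition rpn_value :: "('a \<Rightarrow> 'a \<Rightarrow> 'a) \<Rightarrow> (nat \<Rightarrow> 'a) \<Rightarrow> letter list \<Rightarrow> 'a" where
  "rpn_value f g u = hd (fold (rpn_step f g) u [])"

text \<open>
  A groupoid is given by its carrier \<open>G\<close> and an operation \<open>f\<close>, which matters only on \<open>G\<close>;
  \<open>G\<^sup>\<omega>\<close> is rendered as the functions \<open>g\<close> on the naturals with all values in \<open>G\<close>.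
\<close>

definition groupoid :: "'a set \<Rightarrow> ('a \<Rightarrow> 'a \<Rightarrow> 'a) \<Rightarrow> bool" where
  "groupoid G f \<longleftrightarrow> (\<forall>a\<in>G. \<forall>b\<in>G. f a b \<in> G)"

definition k_dissociative :: "'a set \<Rightarrow> ('a \<Rightarrow> 'a \<Rightarrow> 'a) \<Rightarrow> nat \<Rightarrow> bool" where
  "k_dissociative G f k \<longleftrightarrow>
    (\<forall>u\<in>formal_products k. \<forall>v\<in>formal_products k. u \<noteq> v \<longrightarrow>
       (\<exists>g. (\<forall>i. g i \<in> G) \<and> rpn_value f g u \<noteq> rpn_value f g v))"

definition completely_dissociative :: "'a set \<Rightarrow> ('a \<Rightarrow> 'a \<Rightarrow> 'a) \<Rightarrow> bool" where
  "completely_dissociative G f \<longleftrightarrow> (\<forall>k\<ge>3. k_dissociative G f k)"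

definition nand :: "nat \<Rightarrow> nat \<Rightarrow> nat" where
  "nand a b = (if a = 1 \<and> b = 1 then 0 else 1)"

lemma nand_table: "nand 0 0 = 1" "nand 0 1 = 1" "nand 1 0 = 1" "nand 1 1 = 0"
  by (simp_all add: nand_def)

lemma groupoid_nand: "groupoid {0, 1} nand"
  by (simp add: groupoid_def nand_def)

end

theory Submission
  imports Defs
begin

text \<open>
  A formal product is the reverse Polish form of a binary tree whose leaves, read from left to
  right, are \<open>0, \<dots>, k - 1\<close> (\<open>formal_product_is_rpn\<close>), and its NAND value is the truth value of the
  formula in which a leaf is a propositional variable and an inner node with subtrees \<open>A\<close>, \<open>B\<close> is
  \<open>\<not> (A \<and> B)\<close>.  So the claim is that such a read-once formula can be recovered from the Boolean
  function that it defines together with the order of its leaves.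

  Suppose that \<open>\<not> (A \<and> B)\<close> and \<open>\<not> (A' \<and> B')\<close> define the same function, so that \<open>A \<and> B\<close> and
  \<open>A' \<and> B'\<close> do.  If both split the leaves at the same place, then \<open>A\<close> and \<open>A'\<close> are equivalent, since
  the other conjuncts can be made true without touching their variables, and likewise for \<open>B\<close>
  and \<open>B'\<close>; induction applies.  The splits cannot differ (\<open>conjunction_split_unique\<close>): if \<open>A'\<close> had
  more leaves than \<open>A\<close>, fixing the variables of \<open>B'\<close> so that \<open>B'\<close> holds would write \<open>A'\<close> as a
  conjunction of functions of an initial and a final segment of its variables.  But \<open>A'\<close> has at
  least two leaves, so it is \<open>\<not> P \<or> \<not> Q\<close>, and a disjunction that depends on all its variables
  cannot also be a conjunction: \<open>P\<close> or \<open>Q\<close> has all its variables on one side of the cut, and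
  falsifying it makes the conjunct on the other side constantly true.
\<close>

section \<open>Parsing formal products\<close>

datatype 'a formula = Leaf 'a | Node "'a formula" "'a formula"

fun leaves :: "'a formula \<Rightarrow> 'a list" where
  "leaves (Leaf i) = [i]"
| "leaves (Node s t) = leaves s @ leaves t"

fun rpn :: "nat formula \<Rightarrow> letter list" where
  "rpn (Leaf i) = [Var i]"
| "rpn (Node s t) = rpn s @ rpn t @ [Bullet]"

lemma leaves_nonempty [simp]: "leaves t \<noteq> []"
  by (induction t) auto

lemma filter_variables_rpn: "filter (\<lambda>c. c \<noteq> Bullet) (rpn t) = map Var (leaves t)"
  by (induction t) auto

lemma count_Bullet_plus_variables:
  "count_list u Bullet + length (filter (\<lambda>c. c \<noteq> Bullet) u) = length u"
  by (induction u) auto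

text \<open>
  Run the stack machine on words instead of values: reading a variable pushes a leaf, and
  reading a bullet joins the top two trees, which exist because the prefix condition still
  holds after the bullet.
\<close>

lemma positive_word_is_rpn_forest:
  assumes "\<And>p. prefix p u \<Longrightarrow> p \<noteq> [] \<Longrightarrow>
             count_list p Bullet < length (filter (\<lambda>c. c \<noteq> Bullet) p)"
  shows "\<exists>ts. u = concat (map rpn ts) \<and>
           length ts + count_list u Bullet = length (filter (\<lambda>c. c \<noteq> Bullet) u)"
  using assms
proof (induction u rule: rev_induct)
  case Nil
  show ?case by simp
next
  case (snoc c u)
  from snoc.IH snoc.prems obtain ts where ts: "u = concat (map rpn ts)"
    "length ts + count_list u Bullet = length (filter (\<lambda>c. c \<noteq> Bullet) u)"
    by (meson prefix_order.trans prefixI)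
  show ?case
  proof (cases c)
    case Bullet
    have "2 \<le> length ts"
      using snoc.prems[of "u @ [c]"] ts(2) Bullet by simp
    then obtain rs s t where "ts = rs @ [s, t]"
      by (metis (no_types, opaque_lifting) One_nat_def Suc_1 append.assoc append_Cons append_Nil
          length_0_conv length_Suc_conv_rev not_numeral_le_zero le_Suc_ex add_Suc)
    then show ?thesis
      using ts Bullet by (intro exI[of _ "rs @ [Node s t]"]) auto
  next
    case (Var i)
    then show ?thesis
      using ts by (intro exI[of _ "ts @ [Leaf i]"]) auto
  qed
qed

text \<open>
  The word has \<open>k\<close> letters other than bullets, so containing \<open>x\<^sub>0 \<dots> x\<^sub>k\<^sub>-\<^sub>1\<close> as a subsequence
  leaves no room for any other variable; the forest of the parse is a single tree because
  there is one bullet less than there are variables.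
\<close>

lemma formal_product_is_rpn:
  assumes u: "u \<in> formal_products k" and "k \<ge> 1"
  obtains t where "u = rpn t" "leaves t = [0..<k]"
proof -
  let ?vars = "filter (\<lambda>c. c \<noteq> Bullet)"
  have counts: "count_list u Bullet = k - 1" "length (?vars u) = k"
    using u \<open>k \<ge> 1\<close> count_Bullet_plus_variables[of u] by (auto simp: formal_products_def)
  have "subseq (?vars (map Var [0..<k])) (?vars u)"
    using u by (intro subseq_filter) (simp add: formal_products_def)
  moreover have "?vars (map Var [0..<k]) = map Var [0..<k]"
    by (simp add: filter_map o_def)
  ultimately have vars: "?vars u = map Var [0..<k]"
    using counts(2) subseq_same_length by fastforce
  obtain ts where ts: "u = concat (map rpn ts)"
    "length ts + count_list u Bullet = length (?vars u)"
    using positive_word_is_rpn_forest[of u] u by (auto simp: formal_products_def)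
  with counts \<open>k \<ge> 1\<close> have "length ts = 1" by simp
  with ts(1) obtain t where t: "u = rpn t"
    by (auto simp: length_Suc_conv)
  then have "map Var (leaves t) = map Var [0..<k]"
    using vars by (simp add: filter_variables_rpn)
  then have "leaves t = [0..<k]"
    by (simp add: inj_map_eq_map inj_def)
  with t show ?thesis by (rule that)
qed

section \<open>NAND formulas as Boolean functions\<close>

fun holds :: "('a \<Rightarrow> bool) \<Rightarrow> 'a formula \<Rightarrow> bool" where
  "holds g (Leaf i) \<longleftrightarrow> g i"
| "holds g (Node s t) \<longleftrightarrow> \<not> (holds g s \<and> holds g t)"

lemma rpn_fold_nand:
  "fold (rpn_step nand (\<lambda>i. of_bool (g i))) (rpn t) st = of_bool (holds g t) # st"
  by (induction t arbitrary: st) (auto simp: nand_def)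

lemma rpn_value_nand:
  "rpn_value nand (\<lambda>i. of_bool (g i)) (rpn t) = of_bool (holds g t)"
  by (simp add: rpn_value_def rpn_fold_nand)

lemma holds_cong:
  "(\<And>i. i \<in> set (leaves t) \<Longrightarrow> g i = h i) \<Longrightarrow> holds g t = holds h t"
  by (induction t) auto

lemma holds_override_inside:
  "set (leaves t) \<subseteq> S \<Longrightarrow> holds (override_on h g S) t = holds g t"
  by (rule holds_cong) auto

lemma holds_override_outside:
  "set (leaves t) \<inter> S = {} \<Longrightarrow> holds (override_on h g S) t = holds h t"
  by (rule holds_cong) (metis disjoint_iff override_on_apply_notin)

lemma formula_attains_both_values:
  assumes "distinct (leaves t)"
  shows "\<exists>g. holds g t = b"
  using assms
proof (induction t arbitrary: b)
  case (Leaf i)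
  show ?case by (rule exI[of _ "\<lambda>_. b"]) simp
next
  case (Node s t)
  then obtain g h where "holds g s = (\<not> b)" "holds h t = (\<not> b)"
    by (metis distinct_append leaves.simps(2))
  moreover have "set (leaves t) \<inter> set (leaves s) = {}"
    using Node.prems by auto
  ultimately show ?case
    by (intro exI[of _ "override_on h g (set (leaves s))"])
       (simp add: holds_override_inside holds_override_outside)
qed

text \<open>
  Making the sibling of a subtree true turns \<open>\<not> (A \<and> B)\<close> into the negation of that subtree, so
  a dependence on a variable is passed on to the root.
\<close>

lemma formula_depends_on_each_leaf:
  assumes "distinct (leaves t)" "i \<in> set (leaves t)"
  shows "\<exists>g. holds (g(i := True)) t \<noteq> holds (g(i := False)) t"
  using assms
proof (induction t)
  case (Leaf j)
  then show ?case by simp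
next
  case (Node s t)
  have extend: "\<exists>g. (holds (g(i := True)) r \<noteq> holds (g(i := False)) r) \<and>
                    holds (g(i := True)) r' \<and> holds (g(i := False)) r'"
    if dep: "\<exists>g. holds (g(i := True)) r \<noteq> holds (g(i := False)) r"
      and disj: "set (leaves r') \<inter> set (leaves r) = {}"
      and i: "i \<in> set (leaves r)" and d: "distinct (leaves r')" for r r' :: "'a formula"
  proof -
    from dep obtain g where g: "holds (g(i := True)) r \<noteq> holds (g(i := False)) r" by blast
    from formula_attains_both_values[OF d, of True] obtain h where h: "holds h r'" by auto
    let ?f = "override_on h g (set (leaves r))"
    have "holds (?f(i := b)) r = holds (g(i := b)) r" for b
      by (rule holds_cong) auto
    moreover have "holds (?f(i := b)) r' = holds h r'" for b
      using disj i by (intro holds_cong) (auto simp: override_on_def)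
    ultimately show ?thesis using g h by blast
  qed
  have disj: "set (leaves s) \<inter> set (leaves t) = {}" and d: "distinct (leaves s)" "distinct (leaves t)"
    using Node.prems(1) by auto
  consider "i \<in> set (leaves s)" | "i \<in> set (leaves t)" using Node.prems(2) by auto
  then show ?case
  proof cases
    case 1
    with extend[OF Node.IH(1)[OF d(1)], of t] d disj show ?thesis
      unfolding holds.simps by (metis Int_commute)
  next
    case 2
    with extend[OF Node.IH(2)[OF d(2)], of s] d disj show ?thesis
      unfolding holds.simps by metis
  qed
qed

section \<open>Recovering a formula from its function\<close>

text \<open>
  With \<open>b\<close> satisfying \<open>B'\<close>, the function of \<open>A'\<close> is the conjunction of that of \<open>A\<close> and of a function
  of the variables \<open>us\<close>, namely \<open>B\<close> with the variables of \<open>B'\<close> set to \<open>b\<close>.  Since \<open>A'\<close> is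
  \<open>\<not> P \<or> \<not> Q\<close>, it suffices to see which of the two conjuncts is blind to the variables of \<open>P\<close>
  or to those of \<open>Q\<close>.
\<close>

lemma conjunction_split_unique:
  assumes eq: "\<And>g. (holds g A \<and> holds g B) = (holds g A' \<and> holds g B')"
    and A': "leaves A' = leaves A @ us" and B: "leaves B = us @ leaves B'"
    and d: "distinct (leaves A @ leaves B)"
  shows "us = []"
proof (rule ccontr)
  assume "us \<noteq> []"
  then obtain i where i: "i \<in> set us" by fastforce
  have dA': "distinct (leaves A')" and dB': "distinct (leaves B')" and dA: "distinct (leaves A)"
    using d A' B by auto
  obtain P Q where PQ: "A' = Node P Q"
    using A' \<open>us \<noteq> []\<close> by (cases A') (auto simp: Cons_eq_append_conv)
  obtain b where b: "holds b B'"
    using formula_attains_both_values[OF dB', of True] by auto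
  define fix_B' where "fix_B' g = override_on b g (set (leaves A'))" for g
  have conj: "holds g A' \<longleftrightarrow> holds g A \<and> holds (fix_B' g) B" for g
  proof -
    have "holds (fix_B' g) A' = holds g A'" "holds (fix_B' g) A = holds g A"
      unfolding fix_B'_def using A' by (auto intro!: holds_override_inside)
    moreover have "holds (fix_B' g) B' = holds b B'"
      unfolding fix_B'_def using A' B d by (intro holds_override_outside) auto
    ultimately show ?thesis using eq[of "fix_B' g"] b by auto
  qed
  have "leaves P @ leaves Q = leaves A @ us"
    using A' PQ by simp
  then consider ws where "leaves P = leaves A @ ws" "us = ws @ leaves Q"
    | ws where "leaves A = leaves P @ ws" "leaves Q = ws @ us"
    by (fastforce simp: append_eq_append_conv2)
  then show False
  proof cases
    case 1
    obtain q where q: "\<not> holds q Q"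
      using formula_attains_both_values[of Q False] dA' PQ by auto
    obtain g where g: "\<not> holds g A"
      using formula_attains_both_values[OF dA, of False] by auto
    \<comment> \<open>\<open>A\<close> does not see the variables of \<open>Q\<close>, so falsifying \<open>Q\<close> makes \<open>A'\<close> true while \<open>A\<close> stays false\<close>
    let ?h = "override_on g q (set (leaves Q))"
    have "holds ?h A'"
      using q PQ by (simp add: holds_override_inside)
    moreover have "holds ?h A = holds g A"
      using d B 1 by (intro holds_override_outside) auto
    ultimately show False using conj g by blast
  next
    case 2
    obtain p where p: "\<not> holds p P"
      using formula_attains_both_values[of P False] dA' PQ by auto
    \<comment> \<open>\<open>B\<close> does not see the variables of \<open>P\<close>, so falsifying \<open>P\<close> shows that the second conjunct\<close>
    \<comment> \<open>is always true; then \<open>A'\<close> ignores \<open>us\<close>\<close>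
    have "holds (fix_B' g) B" for g
    proof -
      let ?h = "override_on g p (set (leaves P))"
      have "holds ?h A'"
        using p PQ by (simp add: holds_override_inside)
      then have "holds (fix_B' ?h) B" using conj by blast
      moreover have "holds (fix_B' ?h) B = holds (fix_B' g) B"
        unfolding fix_B'_def using d 2 by (intro holds_cong) (auto simp: override_on_def)
      ultimately show ?thesis by simp
    qed
    then have A'_A: "holds g A' = holds g A" for g using conj by blast
    have "holds (g(i := True)) A = holds (g(i := False)) A" for g
      using i d B by (intro holds_cong) auto
    then show False
      using formula_depends_on_each_leaf[OF dA', of i] i A' A'_A by auto
  qed
qed

text \<open>
  To compare \<open>A\<close> with \<open>A'\<close> at a given assignment, change it on the variables of the other conjunct
  alone so that this conjunct becomes true.
\<close>

lemma conjuncts_unique: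
  assumes eq: "\<And>g. (holds g A \<and> holds g B) = (holds g A' \<and> holds g B')"
    and A: "leaves A = leaves A'" and B: "leaves B = leaves B'"
    and d: "distinct (leaves A @ leaves B)"
  shows "holds g A = holds g A'" "holds g B = holds g B'"
proof -
  have transfer: "holds g S'"
    if imp: "\<And>g. holds g S \<Longrightarrow> holds g T \<Longrightarrow> holds g S'" and g: "holds g S"
      and T: "distinct (leaves T)" "set (leaves T) \<inter> set (leaves S) = {}"
      and S': "leaves S = leaves S'" for g and S S' T :: "'a formula"
  proof -
    obtain h where "holds h T"
      using formula_attains_both_values[OF T(1), of True] by auto
    then show ?thesis
      using imp[of "override_on h g (set (leaves S))"] g T(2) S'
      by (simp add: holds_override_inside holds_override_outside)
  qed
  show "holds g A = holds g A'"
  proof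
    show "holds g A'" if "holds g A"
      using that by (rule transfer[of A B, rotated]) (use eq A d in auto)
    show "holds g A" if "holds g A'"
      using that by (rule transfer[of A' B', rotated]) (use eq A B d in auto)
  qed
  show "holds g B = holds g B'"
  proof
    show "holds g B'" if "holds g B"
      using that by (rule transfer[of B A, rotated]) (use eq B d in auto)
    show "holds g B" if "holds g B'"
      using that by (rule transfer[of B' A', rotated]) (use eq A B d in auto)
  qed
qed

lemma formula_determined_by_function:
  assumes "distinct (leaves s)" "leaves s = leaves t" "\<And>g. holds g s = holds g t"
  shows "s = t"
  using assms
proof (induction s arbitrary: t)
  case (Leaf i)
  then show ?case by (cases t) (auto simp: Cons_eq_append_conv)
next
  case (Node A B)
  show ?case
  proof (cases t)
    case (Leaf i)
    then show ?thesis using Node.prems(2) by (auto simp: append_eq_Cons_conv)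
  next
    case t: (Node A' B')
    have eq: "(holds g A \<and> holds g B) = (holds g A' \<and> holds g B')" for g
      using Node.prems(3)[of g] t by auto
    have app: "leaves A @ leaves B = leaves A' @ leaves B'"
      using Node.prems(2) t by simp
    have d: "distinct (leaves A @ leaves B)"
      using Node.prems(1) by simp
    then have d': "distinct (leaves A' @ leaves B')"
      unfolding app .
    from app consider us where "leaves A' = leaves A @ us" "leaves B = us @ leaves B'"
      | us where "leaves A = leaves A' @ us" "leaves B' = us @ leaves B"
      by (fastforce simp: append_eq_append_conv2)
    then have same: "leaves A = leaves A' \<and> leaves B = leaves B'"
    proof cases
      case 1
      with conjunction_split_unique[OF eq 1 d] show ?thesis by simp
    next
      case 2
      with conjunction_split_unique[OF eq[symmetric] 2 d'] show ?thesis by simp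
    qed
    then have "holds g A = holds g A'" "holds g B = holds g B'" for g
      using conjuncts_unique[OF eq _ _ d] by simp_all
    then show ?thesis
      using Node.IH same d t by simp
  qed
qed

theorem theorem3p6:
  shows "completely_dissociative {0, 1} nand"
  unfolding completely_dissociative_def k_dissociative_def
proof (intro allI ballI impI)
  fix k :: nat and u v
  assume "3 \<le> k" and u: "u \<in> formal_products k" and v: "v \<in> formal_products k" and "u \<noteq> v"
  then have "1 \<le> k" by simp
  obtain s where s: "u = rpn s" "leaves s = [0..<k]"
    by (rule formal_product_is_rpn[OF u \<open>1 \<le> k\<close>])
  obtain t where t: "v = rpn t" "leaves t = [0..<k]"
    by (rule formal_product_is_rpn[OF v \<open>1 \<le> k\<close>])
  from s t \<open>u \<noteq> v\<close> obtain g where "holds g s \<noteq> holds g t"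
    using formula_determined_by_function[of s t] by auto
  then have "rpn_value nand (\<lambda>i. of_bool (g i)) u \<noteq> rpn_value nand (\<lambda>i. of_bool (g i)) v"
    using s t by (simp add: rpn_value_nand)
  then show "\<exists>g. (\<forall>i. g i \<in> {0, 1}) \<and> rpn_value nand g u \<noteq> rpn_value nand g v"
    by (intro exI[of _ "\<lambda>i. of_bool (g i)"]) auto
qed

end
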